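(* Let $f_1,\dots,f_N:\mathbb R^n\to\mathbb R\cup\{+\infty\}$ be closed and proper, and suppose that $(x_1,\dots,x_N)\mapsto\sum_{i=1}^N f_i(x_i)$ is $m_f$-strongly convex with $m_f>0$. Let $z^*$ be the optimal solution of $\min_{x_1,\dots,x_N,z}\sum_{i=1}^N f_i(x_i)$ s.t. $x_i=z$ for all $i$, with optimal dual variables $\lambda^*=(\lambda_1^*,\dots,\lambda_N^* )$, and let $$\mathscr L(z,\lambda)=\frac1\rho\sum_{i=1}^N\|\lambda_i-\lambda_i^*\|^2+\rho N\|z-z^*\|^2 .$$ Suppose there exists $\delta>0$ such that at every iteration $(z,\lambda)\mapsto(z^+,\lambda^+)$ of Reduced Consensus ALADIN $$\delta\,\mathscr L(z^+,\lambda^+)\le 4m_f\sum_{i=1}^N\|x_i^+-z^*\|^2 .$$ Then the iterates of Reduced Consensus ALADIN converge Q-linearly to a unique optimal solution, namely $(z^*,\lambda^* )$, with rate $\frac1{\sqrt{1+\delta}}$; i.e., measuring the distance of $(z,\lambda)$ to $(z^*,\lambda^* )$ by $\mathscr L(z,\lambda)^{1/2}$, $$\mathscr L(z^+,\lambda^+)^{1/2}\le\frac{1}{\sqrt{1+\delta}}\,\mathscr L(z,\lambda)^{1/2}$$ at every iteration.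
   Context: $\|\cdot\|$ is the Euclidean norm and $\rho>0$ is a fixed parameter. One iteration of Reduced Consensus ALADIN maps $(z,\lambda)$, with $z\in\mathbb R^n$, $\lambda=(\lambda_1,\dots,\lambda_N)\in(\mathbb R^n)^N$ and $\sum_{i=1}^N\lambda_i=0$, to $(z^+,\lambda^+)$ by $$x_i^+=\arg\min_{x_i} f_i(x_i)+\lambda_i^\top x_i+\tfrac{\rho}{2}\|x_i-z\|^2,\qquad g_i=\rho(z-x_i^+)-\lambda_i,$$ $$z^+=\frac1N\sum_{i=1}^N\Big(x_i^+-\frac{g_i}{\rho}\Big),\qquad \lambda_i^+=\rho(x_i^+-z^+)-g_i .$$ The update preserves $\sum_i\lambda_i=0$. Optimal dual variables are multipliers $\lambda_i^*$ of the constraints $x_i=z$ satisfying, together with $z^*$, the optimality conditions $-\lambda_i^*\in\partial f_i(z^* )$ for all $i$ and $\sum_{i=1}^N\lambda_i^*=0$. A function $F$ is $m_f$-strongly convex if $F-\frac{m_f}{2}\|\cdot\|^2$ is convex. *)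

theory Defs
  imports "HOL-Analysis.Analysis"
begin

definition ereal_epigraph :: "('a \<Rightarrow> ereal) \<Rightarrow> ('a \<times> real) set" where
  "ereal_epigraph f = {(x, r). f x \<le> ereal r}"

definition proper_fun :: "('a \<Rightarrow> ereal) \<Rightarrow> bool" where
  "proper_fun f \<longleftrightarrow> (\<forall>x. f x \<noteq> -\<infinity>) \<and> (\<exists>x. f x \<noteq> \<infinity>)"

definition closed_fun :: "('a::topological_space \<Rightarrow> ereal) \<Rightarrow> bool" where
  "closed_fun f \<longleftrightarrow> closed (ereal_epigraph f)"

definition convex_fun :: "('a::real_vector \<Rightarrow> ereal) \<Rightarrow> bool" where
  "convex_fun f \<longleftrightarrow> convex (ereal_epigraph f)"

definition strongly_convex_fun :: "real \<Rightarrow> ('a::real_normed_vector \<Rightarrow> ereal) \<Rightarrow> bool" where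
  "strongly_convex_fun m f \<longleftrightarrow> convex_fun (\<lambda>x. f x - ereal (m / 2 * (norm x)\<^sup>2))"

definition subdifferential :: "('a::real_inner \<Rightarrow> ereal) \<Rightarrow> 'a \<Rightarrow> 'a set" where
  "subdifferential f x = {g. \<bar>f x\<bar> \<noteq> \<infinity> \<and> (\<forall>y. f x + ereal (g \<bullet> (y - x)) \<le> f y)}"

text \<open>A tuple of \<open>N\<close> vectors is an element of \<^typ>\<open>real^'n^'N\<close>, whose library norm is the
  Euclidean norm of the stacked vector.\<close>

definition separable_sum :: "('N::finite \<Rightarrow> real^'n \<Rightarrow> ereal) \<Rightarrow> real^'n^'N \<Rightarrow> ereal" where
  "separable_sum f x = (\<Sum>i\<in>UNIV. f i (x $ i))"

definition consensus_solution ::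
    "('N::finite \<Rightarrow> real^'n \<Rightarrow> ereal) \<Rightarrow> real^'n^'N \<Rightarrow> real^'n \<Rightarrow> bool" where
  "consensus_solution f x z \<longleftrightarrow>
     is_arg_min (\<lambda>(x, z). separable_sum f x) (\<lambda>(x, z). \<forall>i. x $ i = z) (x, z)"

definition optimal_duals ::
    "('N::finite \<Rightarrow> real^'n \<Rightarrow> ereal) \<Rightarrow> real^'n \<Rightarrow> real^'n^'N \<Rightarrow> bool" where
  "optimal_duals f z lam \<longleftrightarrow>
     (\<forall>i. - (lam $ i) \<in> subdifferential (f i) z) \<and> (\<Sum>i\<in>UNIV. lam $ i) = 0"

text \<open>\<open>arg_min\<close> picks an arbitrary vector when no minimizer exists. For closed, proper, strongly
  convex \<open>f i\<close> and \<open>rho > 0\<close> the minimizer exists and is unique.\<close>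

definition local_min ::
    "('N::finite \<Rightarrow> real^'n \<Rightarrow> ereal) \<Rightarrow> real \<Rightarrow> (real^'n) \<times> (real^'n^'N) \<Rightarrow> real^'n^'N" where
  "local_min f rho = (\<lambda>(z, lam). \<chi> i.
     arg_min (\<lambda>y. f i y + ereal (lam $ i \<bullet> y) + ereal (rho / 2 * (norm (y - z))\<^sup>2)) (\<lambda>_. True))"

definition aladin_step ::
    "('N::finite \<Rightarrow> real^'n \<Rightarrow> ereal) \<Rightarrow> real \<Rightarrow> (real^'n) \<times> (real^'n^'N) \<Rightarrow> (real^'n) \<times> (real^'n^'N)"
  where
  "aladin_step f rho = (\<lambda>(z, lam).
     let x = local_min f rho (z, lam);
         g = (\<chi> i. rho *\<^sub>R (z - x $ i) - lam $ i);
         z' = (1 / real CARD('N)) *\<^sub>R (\<Sum>i\<in>UNIV. x $ i - (1 / rho) *\<^sub>R (g $ i));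
         lam' = (\<chi> i. rho *\<^sub>R (x $ i - z') - g $ i)
     in (z', lam'))"

definition lyapunov ::
    "real \<Rightarrow> (real^'n) \<times> (real^'n^'N::finite) \<Rightarrow> (real^'n) \<times> (real^'n^'N) \<Rightarrow> real" where
  "lyapunov rho = (\<lambda>(zs, lams) (z, lam).
     1 / rho * (\<Sum>i\<in>UNIV. (norm (lam $ i - lams $ i))\<^sup>2)
     + rho * real CARD('N) * (norm (z - zs))\<^sup>2)"

definition descent_condition ::
    "('N::finite \<Rightarrow> real^'n \<Rightarrow> ereal) \<Rightarrow> real \<Rightarrow> real \<Rightarrow> real \<Rightarrow> (real^'n) \<times> (real^'n^'N)
      \<Rightarrow> (real^'n) \<times> (real^'n^'N) \<Rightarrow> bool" where
  "descent_condition f rho m \<delta> sol s \<longleftrightarrow>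
     \<delta> * lyapunov rho sol (aladin_step f rho s)
       \<le> 4 * m * (\<Sum>i\<in>UNIV. (norm (local_min f rho s $ i - fst sol))\<^sup>2)"

end

theory Submission
  imports Defs
begin

text \<open>Write \<open>a\<^sub>i = rho (x\<^sub>i - zs)\<close> and \<open>b\<^sub>i = g\<^sub>i + lams\<^sub>i\<close>, where \<open>x\<^sub>i\<close> is the local minimizer and
  \<open>g\<^sub>i = rho (z - x\<^sub>i) - lam\<^sub>i\<close>. When the dual variables sum to zero, the cross terms in
  \<open>\<Sum>\<^sub>i \<parallel>lam\<^sub>i - lams\<^sub>i \<plusminus> rho (z - zs)\<parallel>\<^sup>2\<close> cancel, so either sign gives \<open>rho\<close> times the Lyapunov function
  (\<open>lyapunov_eq_sum\<close>). Taking the minus sign before the step and the plus sign after it, one finds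
  that the Lyapunov function moves from \<open>(1/rho) \<Sum>\<^sub>i \<parallel>a\<^sub>i + b\<^sub>i\<parallel>\<^sup>2\<close> to \<open>(1/rho) \<Sum>\<^sub>i \<parallel>a\<^sub>i - b\<^sub>i\<parallel>\<^sup>2\<close>: the
  step reverses the sign of every \<open>b\<^sub>i\<close>, and the decrease is exactly
  \<open>4 \<Sum>\<^sub>i (g\<^sub>i + lams\<^sub>i) \<bullet> (x\<^sub>i - zs)\<close> (\<open>lyapunov_aladin_step\<close>).

  Here \<open>g\<^sub>i\<close> is a subgradient of \<open>f\<^sub>i\<close> at \<open>x\<^sub>i\<close> by optimality of \<open>x\<^sub>i\<close>, and \<open>- lams\<^sub>i\<close> is one at \<open>zs\<close>. Strong
  convexity of the separable sum is inherited by every \<open>f\<^sub>i\<close> and makes subgradients strongly monotone,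
  so the decrease is at least \<open>4 m \<Sum>\<^sub>i \<parallel>x\<^sub>i - zs\<parallel>\<^sup>2\<close>, which by the descent condition is at least
  \<open>\<delta>\<close> times the new value. This is the contraction by \<open>1 / sqrt (1 + \<delta>)\<close>; iterating it drives the
  Lyapunov function, and hence the distance to the solution, to zero.

  The primal solution is unique by strong convexity along the diagonal. Any optimal pair is a fixed
  point of the iteration at which \<open>x\<^sub>i = zs\<close>, so there the descent condition itself forces the
  Lyapunov function to vanish; this makes the dual solution unique too.\<close>

section \<open>Strong convexity and proximal subgradients\<close>

text \<open>With \<open>r = 0\<close> this is an ordinary subgradient. Allowing the quadratic defect lets the optimality of a
  minimizer of \<open>h\<close> plus a quadratic be stated without a sum rule for subdifferentials.\<close>

definition proximal_subgradient :: "real \<Rightarrow> ('a::real_inner \<Rightarrow> ereal) \<Rightarrow> 'a \<Rightarrow> 'a \<Rightarrow> bool" where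
  "proximal_subgradient r h x g \<longleftrightarrow> \<bar>h x\<bar> \<noteq> \<infinity> \<and>
     (\<forall>w. h x + ereal (g \<bullet> (w - x) - r / 2 * (norm (w - x))\<^sup>2) \<le> h w)"

lemma subdifferential_iff_proximal_subgradient:
  "g \<in> subdifferential h x \<longleftrightarrow> proximal_subgradient 0 h x g"
  by (simp add: subdifferential_def proximal_subgradient_def)

lemma norm_convex_combination:
  fixes x y :: "'a::real_inner"
  shows "(norm ((1 - t) *\<^sub>R x + t *\<^sub>R y))\<^sup>2
    = (1 - t) * (norm x)\<^sup>2 + t * (norm y)\<^sup>2 - t * (1 - t) * (norm (y - x))\<^sup>2"
  unfolding power2_norm_eq_inner
  by (simp add: inner_commute algebra_simps power2_eq_square)

lemma strongly_convex_fun_upper_bound: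
  fixes h :: "'a::real_inner \<Rightarrow> ereal"
  assumes "strongly_convex_fun m h" "h x = ereal a" "h y = ereal b" "0 \<le> t" "t \<le> 1"
  shows "h ((1 - t) *\<^sub>R x + t *\<^sub>R y)
    \<le> ereal ((1 - t) * a + t * b - m / 2 * (t * (1 - t)) * (norm (y - x))\<^sup>2)"
proof -
  let ?E = "ereal_epigraph (\<lambda>x. h x - ereal (m / 2 * (norm x)\<^sup>2))"
  have cvx: "convex ?E"
    using assms(1) by (simp add: strongly_convex_fun_def convex_fun_def)
  have "(x, a - m / 2 * (norm x)\<^sup>2) \<in> ?E" "(y, b - m / 2 * (norm y)\<^sup>2) \<in> ?E"
    by (simp_all add: ereal_epigraph_def assms)
  from convexD[OF cvx this, of "1 - t" t] assms(4,5)
  have "((1 - t) *\<^sub>R x + t *\<^sub>R y,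
      (1 - t) * (a - m / 2 * (norm x)\<^sup>2) + t * (b - m / 2 * (norm y)\<^sup>2)) \<in> ?E"
    by simp
  then have *: "h ((1 - t) *\<^sub>R x + t *\<^sub>R y) \<le>
      ereal ((1 - t) * (a - m / 2 * (norm x)\<^sup>2) + t * (b - m / 2 * (norm y)\<^sup>2)
        + m / 2 * (norm ((1 - t) *\<^sub>R x + t *\<^sub>R y))\<^sup>2)"
    by (cases "h ((1 - t) *\<^sub>R x + t *\<^sub>R y)") (simp_all add: ereal_epigraph_def, linarith)
  have "(1 - t) * (a - m / 2 * (norm x)\<^sup>2) + t * (b - m / 2 * (norm y)\<^sup>2)
        + m / 2 * (norm ((1 - t) *\<^sub>R x + t *\<^sub>R y))\<^sup>2
      = (1 - t) * a + t * b - m / 2 * (t * (1 - t)) * (norm (y - x))\<^sup>2"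
    unfolding norm_convex_combination by (simp add: field_simps)
  with * show ?thesis by (simp only:)
qed

text \<open>Evaluated on the segment from \<open>x\<close> to \<open>y\<close> near \<open>x\<close>, the defect \<open>r\<close> is of second order in the
  step length \<open>t\<close>, whereas the gain from strong convexity is of first order. After division by \<open>t\<close>
  the defect vanishes as \<open>t\<close> tends to zero.\<close>

lemma proximal_subgradient_strongly_convex:
  fixes h :: "'a::real_inner \<Rightarrow> ereal"
  assumes sc: "strongly_convex_fun m h" and prox: "proximal_subgradient r h x g"
    and hx: "h x = ereal a" and hy: "h y = ereal b"
  shows "a + g \<bullet> (y - x) + m / 2 * (norm (y - x))\<^sup>2 \<le> b"
proof -
  let ?D = "(norm (y - x))\<^sup>2"
  have bound: "a + g \<bullet> (y - x) + m / 2 * (1 - t) * ?D - r / 2 * t * ?D \<le> b"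
    if t: "0 < t" "t \<le> 1" for t
  proof -
    let ?w = "(1 - t) *\<^sub>R x + t *\<^sub>R y"
    have w: "?w - x = t *\<^sub>R (y - x)" by (simp add: algebra_simps)
    have "ereal (a + (g \<bullet> (?w - x) - r / 2 * (norm (?w - x))\<^sup>2)) \<le> h ?w"
      using prox hx by (simp add: proximal_subgradient_def)
    also have "\<dots> \<le> ereal ((1 - t) * a + t * b - m / 2 * (t * (1 - t)) * ?D)"
      using strongly_convex_fun_upper_bound[OF sc hx hy] t by simp
    finally have "a + (t * (g \<bullet> (y - x)) - r / 2 * (t\<^sup>2 * ?D))
        \<le> (1 - t) * a + t * b - m / 2 * (t * (1 - t)) * ?D"
      unfolding w by (simp add: power_mult_distrib)
    then have "t * (a + g \<bullet> (y - x) + m / 2 * (1 - t) * ?D - r / 2 * t * ?D) \<le> t * b"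
      by (simp add: algebra_simps power2_eq_square)
    with t show ?thesis by simp
  qed
  have "((\<lambda>t. a + g \<bullet> (y - x) + m / 2 * (1 - t) * ?D - r / 2 * t * ?D)
      \<longlongrightarrow> a + g \<bullet> (y - x) + m / 2 * (1 - 0) * ?D - r / 2 * 0 * ?D) (at_right 0)"
    by (intro tendsto_intros)
  moreover have "\<forall>\<^sub>F t in at_right 0. a + g \<bullet> (y - x) + m / 2 * (1 - t) * ?D - r / 2 * t * ?D \<le> b"
    unfolding eventually_at_right_field using bound by (intro exI[of _ 1]) auto
  ultimately show ?thesis
    using tendsto_upperbound[of _ _ "at_right (0::real)" b] by fastforce
qed

text \<open>The sum of the two strong subgradient inequalities between \<open>x\<close> and \<open>y\<close>: each contributes half
  of the modulus.\<close>

lemma proximal_subgradient_strongly_monotone: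
  fixes h :: "'a::real_inner \<Rightarrow> ereal"
  assumes sc: "strongly_convex_fun m h"
    and p: "proximal_subgradient r h x p" and q: "proximal_subgradient s h y q"
  shows "m * (norm (x - y))\<^sup>2 \<le> (p - q) \<bullet> (x - y)"
proof -
  obtain a b where ab: "h x = ereal a" "h y = ereal b"
    using p q by (auto simp: proximal_subgradient_def)
  have "a + p \<bullet> (y - x) + m / 2 * (norm (y - x))\<^sup>2 \<le> b"
    by (rule proximal_subgradient_strongly_convex[OF sc p ab])
  moreover have "b + q \<bullet> (x - y) + m / 2 * (norm (x - y))\<^sup>2 \<le> a"
    by (rule proximal_subgradient_strongly_convex[OF sc q ab(2,1)])
  moreover have "norm (y - x) = norm (x - y)" by (rule norm_minus_commute)
  moreover have "p \<bullet> (y - x) = - (p \<bullet> (x - y))" by (simp add: inner_diff_right)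
  ultimately show ?thesis by (simp add: inner_diff_left)
qed

text \<open>Freeze all arguments but the \<open>i\<close>-th at a point where every summand is finite. The sum then
  differs from \<open>f i\<close>, and the squared norm of the stacked vector from that of its \<open>i\<close>-th block, only
  by a constant, so the epigraph for \<open>f i\<close> is an affine preimage of the one for the sum.\<close>

lemma strongly_convex_fun_component:
  fixes f :: "'N::finite \<Rightarrow> real^'n \<Rightarrow> ereal"
  assumes sc: "strongly_convex_fun m (separable_sum f)" and fin: "\<And>j. \<bar>f j a\<bar> \<noteq> \<infinity>"
  shows "strongly_convex_fun m (f i)"
proof -
  define X :: "real^'n \<Rightarrow> real^'n^'N" where "X y = (\<chi> j. if j = i then y else a)" for y
  define c where "c = (\<Sum>j\<in>UNIV - {i}. real_of_ereal (f j a))"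
  define d where "d = (\<Sum>j\<in>UNIV - {i}. (norm a)\<^sup>2)"
  let ?F = "\<lambda>x. separable_sum f x - ereal (m / 2 * (norm x)\<^sup>2)"
  let ?f = "\<lambda>y. f i y - ereal (m / 2 * (norm y)\<^sup>2)"
  have sumX: "separable_sum f (X y) = f i y + ereal c" for y
  proof -
    have "separable_sum f (X y) = f i y + (\<Sum>j\<in>UNIV - {i}. f j (X y $ j))"
      unfolding separable_sum_def by (subst sum.remove[of _ i]) (auto simp: X_def)
    also have "(\<Sum>j\<in>UNIV - {i}. f j (X y $ j)) = (\<Sum>j\<in>UNIV - {i}. ereal (real_of_ereal (f j a)))"
      by (intro sum.cong) (auto simp: X_def ereal_real fin)
    finally show ?thesis by (simp add: c_def)
  qed
  have normX: "(norm (X y))\<^sup>2 = (norm y)\<^sup>2 + d" for y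
  proof -
    have "(norm (X y))\<^sup>2 = (\<Sum>j\<in>UNIV. (norm (X y $ j))\<^sup>2)"
      by (simp add: power2_norm_eq_inner inner_vec_def)
    also have "\<dots> = (norm y)\<^sup>2 + (\<Sum>j\<in>UNIV - {i}. (norm (X y $ j))\<^sup>2)"
      by (subst sum.remove[of _ i]) (auto simp: X_def)
    also have "(\<Sum>j\<in>UNIV - {i}. (norm (X y $ j))\<^sup>2) = d"
      unfolding d_def by (intro sum.cong) (auto simp: X_def)
    finally show ?thesis .
  qed
  have epi: "(X y, s + (c - m / 2 * d)) \<in> ereal_epigraph ?F \<longleftrightarrow> (y, s) \<in> ereal_epigraph ?f" for y s
    by (cases "f i y") (auto simp: ereal_epigraph_def sumX normX algebra_simps add_divide_distrib)
  have cvx: "convex (ereal_epigraph ?F)"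
    using sc by (simp add: strongly_convex_fun_def convex_fun_def)
  have "convex (ereal_epigraph ?f)"
  proof (rule convexI)
    fix p q :: "(real^'n) \<times> real" and u v :: real
    assume pq: "p \<in> ereal_epigraph ?f" "q \<in> ereal_epigraph ?f" and uv: "0 \<le> u" "0 \<le> v" "u + v = 1"
    have "(X (fst p), snd p + (c - m / 2 * d)) \<in> ereal_epigraph ?F"
      "(X (fst q), snd q + (c - m / 2 * d)) \<in> ereal_epigraph ?F"
      using pq by (simp_all only: epi prod.collapse)
    from convexD[OF cvx this uv]
    have "(u *\<^sub>R X (fst p) + v *\<^sub>R X (fst q),
        u * (snd p + (c - m / 2 * d)) + v * (snd q + (c - m / 2 * d))) \<in> ereal_epigraph ?F"
      by simp
    moreover have "u *\<^sub>R X (fst p) + v *\<^sub>R X (fst q) = X (u *\<^sub>R fst p + v *\<^sub>R fst q)"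
      using uv(3) by (auto simp: X_def vec_eq_iff simp flip: distrib_right)
    moreover have "u * (snd p + (c - m / 2 * d)) + v * (snd q + (c - m / 2 * d))
        = (u * snd p + v * snd q) + (u + v) * (c - m / 2 * d)"
      by (simp only: distrib_left distrib_right add.assoc add.left_commute)
    ultimately have "(X (u *\<^sub>R fst p + v *\<^sub>R fst q), u * snd p + v * snd q + (c - m / 2 * d))
        \<in> ereal_epigraph ?F"
      by (simp only: uv(3) mult_1)
    then have "(u *\<^sub>R fst p + v *\<^sub>R fst q, u * snd p + v * snd q) \<in> ereal_epigraph ?f"
      by (simp only: epi)
    then show "u *\<^sub>R p + v *\<^sub>R q \<in> ereal_epigraph ?f"
      by (simp add: scaleR_prod_def plus_prod_def)
  qed
  then show ?thesis by (simp add: strongly_convex_fun_def convex_fun_def)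
qed

section \<open>Existence and optimality of the local minimizers\<close>

text \<open>The minimum is sought over the closed epigraph, where the objective becomes the continuous
  function \<open>(y, s) \<mapsto> s + l \<bullet> y + r / 2 \<parallel>y - z\<parallel>\<^sup>2\<close>; this avoids any discussion of
  semicontinuity. A single subgradient bounds \<open>h\<close> below by an affine function, which the quadratic
  dominates, so sublevel sets are compact.\<close>

lemma proximal_objective_attains_minimum:
  fixes h :: "'a::euclidean_space \<Rightarrow> ereal"
  assumes cl: "closed_fun h" and sub: "g \<in> subdifferential h a" and r: "r > 0"
  shows "\<exists>x. is_arg_min (\<lambda>y. h y + ereal (l \<bullet> y) + ereal (r / 2 * (norm (y - z))\<^sup>2)) (\<lambda>_. True) x"
proof -
  define \<phi> :: "'a \<times> real \<Rightarrow> real"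
    where "\<phi> p = snd p + l \<bullet> fst p + r / 2 * (norm (fst p - z))\<^sup>2" for p
  obtain b where ha: "h a = ereal b" and min: "ereal (b + g \<bullet> (y - a)) \<le> h y" for y
    using sub by (force simp: subdifferential_def)
  define S where "S = ereal_epigraph h \<inter> {p. \<phi> p \<le> \<phi> (a, b)}"
  have ab: "(a, b) \<in> S" by (simp add: S_def ereal_epigraph_def ha)
  \<comment> \<open>Completing the square: \<open>z - v\<close> minimizes the quadratic obtained by replacing \<open>h\<close> by its affine minorant.\<close>
  define v where "v = (1 / r) *\<^sub>R (l + g)"
  define K where "K = \<phi> (a, b) - b - l \<bullet> z - g \<bullet> (z - a) + r / 2 * (norm v)\<^sup>2"
  have cont: "continuous_on A \<phi>" for A
    unfolding \<phi>_def by (intro continuous_intros)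
  have "closed {p. \<phi> p \<le> \<phi> (a, b)}"
    using cont by (intro closed_Collect_le) auto
  then have clS: "closed S"
    using cl by (auto simp: S_def closed_fun_def)
  have near: "fst p \<in> cball (z - v) (sqrt (2 * K / r))" if "p \<in> S" for p
  proof -
    obtain y s where p: "p = (y, s)" by (cases p)
    have "ereal (b + g \<bullet> (y - a)) \<le> ereal s"
      using that p by (intro order_trans[OF min[of y]]) (simp add: S_def ereal_epigraph_def)
    then have "b + g \<bullet> (y - a) + l \<bullet> y + r / 2 * (norm (y - z))\<^sup>2 \<le> \<phi> (a, b)"
      using that p by (simp add: S_def \<phi>_def)
    moreover have "r / 2 * (norm (y - (z - v)))\<^sup>2
        = r / 2 * (norm (y - z))\<^sup>2 + (l + g) \<bullet> (y - z) + r / 2 * (norm v)\<^sup>2"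
    proof -
      have "(norm (y - (z - v)))\<^sup>2 = (norm (y - z))\<^sup>2 + 2 * (v \<bullet> (y - z)) + (norm v)\<^sup>2"
        unfolding power2_norm_eq_inner by (simp add: inner_commute algebra_simps)
      moreover have "r * (v \<bullet> (y - z)) = (l + g) \<bullet> (y - z)"
        using r by (simp add: v_def)
      moreover have "r / 2 * ((norm (y - z))\<^sup>2 + 2 * w + (norm v)\<^sup>2)
          = r / 2 * (norm (y - z))\<^sup>2 + r * w + r / 2 * (norm v)\<^sup>2" for w
        by (simp add: field_simps)
      ultimately show ?thesis by (simp only:)
    qed
    ultimately have "r / 2 * (norm (y - (z - v)))\<^sup>2 \<le> K"
      by (simp add: K_def inner_diff_right inner_add_left)
    then have "(norm (y - (z - v)))\<^sup>2 \<le> 2 * K / r"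
      using r by (simp add: field_simps)
    then have "norm (y - (z - v)) \<le> sqrt (2 * K / r)"
      by (rule real_le_rsqrt)
    then show ?thesis by (simp add: p dist_norm norm_minus_commute)
  qed
  have bfst: "bounded (fst ` S)"
    using near by (intro bounded_subset[OF bounded_cball]) blast
  have bounded_on_S: "\<exists>B. \<forall>p\<in>S. \<bar>q (fst p)\<bar> \<le> B" if "continuous_on UNIV q" for q :: "'a \<Rightarrow> real"
  proof -
    have "compact (q ` cball (z - v) (sqrt (2 * K / r)))"
      using that by (intro compact_continuous_image compact_cball) (auto intro: continuous_on_subset)
    from compact_imp_bounded[OF this]
    obtain B where "\<forall>t\<in>q ` cball (z - v) (sqrt (2 * K / r)). \<bar>t\<bar> \<le> B"
      unfolding bounded_iff real_norm_def by blast
    then show ?thesis using near by blast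
  qed
  have "continuous_on UNIV (\<lambda>y. b + g \<bullet> (y - a))" "continuous_on UNIV (\<lambda>y. \<phi> (a, b) - l \<bullet> y)"
    by (intro continuous_intros)+
  then obtain L U where L: "\<And>p. p \<in> S \<Longrightarrow> \<bar>b + g \<bullet> (fst p - a)\<bar> \<le> L"
    and U: "\<And>p. p \<in> S \<Longrightarrow> \<bar>\<phi> (a, b) - l \<bullet> fst p\<bar> \<le> U"
    using bounded_on_S by meson
  have "snd ` S \<subseteq> {- L..U}"
  proof safe
    fix y s assume p: "(y, s) \<in> S"
    have "ereal (b + g \<bullet> (y - a)) \<le> ereal s"
      using p by (intro order_trans[OF min[of y]]) (simp add: S_def ereal_epigraph_def)
    moreover have "s + l \<bullet> y \<le> \<phi> (a, b)"
    proof -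
      have "0 \<le> r / 2 * (norm (y - z))\<^sup>2" using r by simp
      moreover have "s + l \<bullet> y + r / 2 * (norm (y - z))\<^sup>2 \<le> \<phi> (a, b)"
        using p by (simp add: S_def \<phi>_def)
      ultimately show ?thesis by linarith
    qed
    ultimately show "snd (y, s) \<in> {- L..U}" using L[OF p] U[OF p] by auto
  qed
  then have "bounded (snd ` S)" by (rule bounded_subset[OF bounded_closed_interval])
  with bfst have "bounded (fst ` S \<times> snd ` S)" by (rule bounded_Times)
  moreover have "S \<subseteq> fst ` S \<times> snd ` S" by force
  ultimately have "bounded S" by (rule bounded_subset)
  with clS have "compact S" by (simp add: compact_eq_bounded_closed)
  then obtain x s where xs: "(x, s) \<in> S" and opt: "\<And>p. p \<in> S \<Longrightarrow> \<phi> (x, s) \<le> \<phi> p"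
    using continuous_attains_inf[OF _ _ cont, of S] ab by (metis empty_iff surj_pair)
  let ?h = "\<lambda>y. h y + ereal (l \<bullet> y) + ereal (r / 2 * (norm (y - z))\<^sup>2)"
  have "?h x \<le> ?h y" for y
  proof (cases "h y")
    case (real t)
    have "?h x \<le> ereal (\<phi> (x, s))"
      using xs by (cases "h x") (auto simp: S_def ereal_epigraph_def \<phi>_def)
    also have "\<phi> (x, s) \<le> \<phi> (y, t)"
    proof (cases "(y, t) \<in> S")
      case False
      then have "\<phi> (a, b) < \<phi> (y, t)" using real by (auto simp: S_def ereal_epigraph_def)
      with opt[OF ab] show ?thesis by simp
    qed (rule opt)
    finally show ?thesis using real by (simp add: \<phi>_def add.assoc)
  next
    case MInf
    with min[of y] show ?thesis by simp
  qed simp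
  then show ?thesis by (auto simp: is_arg_min_def not_less)
qed

text \<open>The quadratic term equals its linearization at \<open>x\<close> plus \<open>r / 2 \<parallel>w - x\<parallel>\<^sup>2\<close> exactly, so minimality
  is the proximal subgradient inequality rearranged. The subgradient \<open>g\<close> at \<open>a\<close>
  ensures that \<open>h\<close> is finite somewhere and nowhere \<open>-\<infinity>\<close>.\<close>

lemma proximal_subgradient_arg_min:
  fixes h :: "'a::real_inner \<Rightarrow> ereal"
  assumes min: "is_arg_min (\<lambda>y. h y + ereal (l \<bullet> y) + ereal (r / 2 * (norm (y - z))\<^sup>2)) (\<lambda>_. True) x"
    and sub: "g \<in> subdifferential h a"
  shows "proximal_subgradient r h x (r *\<^sub>R (z - x) - l)"
proof -
  have le: "h x + ereal (l \<bullet> x) + ereal (r / 2 * (norm (x - z))\<^sup>2)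
      \<le> h y + ereal (l \<bullet> y) + ereal (r / 2 * (norm (y - z))\<^sup>2)" for y
    using min by (simp add: is_arg_min_linorder)
  obtain b where b: "h a = ereal b" and lower: "ereal (b + g \<bullet> (y - a)) \<le> h y" for y
    using sub by (force simp: subdifferential_def)
  obtain c where c: "h x = ereal c"
    using le[of a] b lower[of x] by (cases "h x") auto
  have "h x + ereal ((r *\<^sub>R (z - x) - l) \<bullet> (w - x) - r / 2 * (norm (w - x))\<^sup>2) \<le> h w" for w
  proof (cases "h w")
    case (real d)
    have "(norm (w - z))\<^sup>2 = (norm (x - z))\<^sup>2 - 2 * ((z - x) \<bullet> (w - x)) + (norm (w - x))\<^sup>2"
      unfolding power2_norm_eq_inner by (simp add: inner_commute algebra_simps)
    then have "r / 2 * (norm (w - z))\<^sup>2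
        = r / 2 * (norm (x - z))\<^sup>2 - r * ((z - x) \<bullet> (w - x)) + r / 2 * (norm (w - x))\<^sup>2"
      by (simp only:) (simp add: algebra_simps)
    moreover have "(r *\<^sub>R (z - x) - l) \<bullet> (w - x) = r * ((z - x) \<bullet> (w - x)) - l \<bullet> w + l \<bullet> x"
      by (simp only: inner_diff_left[of _ l] inner_diff_right[of l] inner_scaleR_left)
    moreover have "c + l \<bullet> x + r / 2 * (norm (x - z))\<^sup>2 \<le> d + l \<bullet> w + r / 2 * (norm (w - z))\<^sup>2"
      using le[of w] by (simp add: c real)
    ultimately have "c + ((r *\<^sub>R (z - x) - l) \<bullet> (w - x) - r / 2 * (norm (w - x))\<^sup>2) \<le> d"
      by linarith
    then show ?thesis by (simp add: c real)
  next
    case MInf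
    with lower[of w] show ?thesis by simp
  qed simp
  with c show ?thesis by (simp add: proximal_subgradient_def)
qed

lemma local_min_proximal_subgradient:
  fixes f :: "'N::finite \<Rightarrow> real^'n \<Rightarrow> ereal"
  assumes "closed_fun (f i)" and sub: "g \<in> subdifferential (f i) a" and "rho > 0"
    and x: "x = local_min f rho (z, lam) $ i"
  shows "proximal_subgradient rho (f i) x (rho *\<^sub>R (z - x) - lam $ i)"
proof (rule proximal_subgradient_arg_min[OF _ sub])
  let ?h = "\<lambda>y. f i y + ereal (lam $ i \<bullet> y) + ereal (rho / 2 * (norm (y - z))\<^sup>2)"
  have "x = arg_min ?h (\<lambda>_. True)" by (simp add: x local_min_def)
  then show "is_arg_min ?h (\<lambda>_. True) x"
    using someI_ex[OF proximal_objective_attains_minimum[OF assms(1-3)]] by (simp add: arg_min_def)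
qed

lemma local_min_strongly_monotone:
  fixes f :: "'N::finite \<Rightarrow> real^'n \<Rightarrow> ereal"
  assumes "closed_fun (f i)" "rho > 0" "strongly_convex_fun m (f i)"
    and sub: "- mu \<in> subdifferential (f i) a"
    and x: "x = local_min f rho (z, lam) $ i"
  shows "m * (norm (x - a))\<^sup>2 \<le> (rho *\<^sub>R (z - x) - lam $ i + mu) \<bullet> (x - a)"
  using proximal_subgradient_strongly_monotone[OF assms(3)
      local_min_proximal_subgradient[of f i "- mu" a rho x z lam] sub[unfolded subdifferential_iff_proximal_subgradient]] assms
  by simp

section \<open>The descent of the Lyapunov function\<close>

text \<open>The new consensus variable is the mean of the points \<open>x\<^sub>i - g\<^sub>i / rho\<close>, and the new dual variables
  are \<open>rho\<close> times the deviations from that mean.\<close>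

lemma aladin_step_sum_duals:
  fixes s :: "(real^'n) \<times> (real^'n^'N::finite)"
  assumes "rho \<noteq> 0"
  shows "(\<Sum>i\<in>UNIV. snd (aladin_step f rho s) $ i) = 0"
proof -
  obtain z lam where s: "s = (z, lam)" by (cases s)
  define x where "x = local_min f rho (z, lam)"
  define g where "g i = rho *\<^sub>R (z - x $ i) - lam $ i" for i
  define p where "p i = x $ i - (1 / rho) *\<^sub>R g i" for i
  define S where "S = (\<Sum>i\<in>UNIV. p i)"
  have "rho *\<^sub>R p i = rho *\<^sub>R x $ i - g i" for i
    using assms by (simp add: p_def scaleR_diff_right)
  moreover have "snd (aladin_step f rho s) $ i
      = rho *\<^sub>R (x $ i - (1 / real CARD('N)) *\<^sub>R S) - g i" for i
    by (simp add: s aladin_step_def Let_def p_def S_def x_def g_def)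
  ultimately have "snd (aladin_step f rho s) $ i = rho *\<^sub>R p i - (rho / real CARD('N)) *\<^sub>R S" for i
    by (simp add: scaleR_diff_right)
  then have "(\<Sum>i\<in>UNIV. snd (aladin_step f rho s) $ i)
      = rho *\<^sub>R S - (rho / real CARD('N)) *\<^sub>R real CARD('N) *\<^sub>R S"
    by (simp only: sum_subtractf scaleR_sum_right[symmetric] sum_constant_scaleR S_def)
  also have "\<dots> = 0" by simp
  finally show ?thesis .
qed

lemma sum_norm_add_centered:
  fixes u :: "'i \<Rightarrow> 'a::real_inner"
  assumes "(\<Sum>i\<in>A. u i) = 0"
  shows "(\<Sum>i\<in>A. (norm (u i + w))\<^sup>2) = (\<Sum>i\<in>A. (norm (u i))\<^sup>2) + real (card A) * (norm w)\<^sup>2"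
proof -
  have "(\<Sum>i\<in>A. (norm (u i + w))\<^sup>2) = (\<Sum>i\<in>A. (norm (u i))\<^sup>2 + (norm w)\<^sup>2 + 2 * (u i \<bullet> w))"
    unfolding power2_norm_eq_inner by (intro sum.cong) (auto simp: inner_commute algebra_simps)
  also have "\<dots> = (\<Sum>i\<in>A. (norm (u i))\<^sup>2) + real (card A) * (norm w)\<^sup>2 + 2 * ((\<Sum>i\<in>A. u i) \<bullet> w)"
    by (simp add: sum.distrib inner_sum_left sum_distrib_left)
  finally show ?thesis using assms by simp
qed

text \<open>The two choices \<open>c = rho\<close> and \<open>c = - rho\<close> are the representations after and before a step.\<close>

lemma lyapunov_eq_sum:
  fixes zs z :: "real^'n" and lams lam :: "real^'n^'N::finite"
  assumes "(\<Sum>i\<in>UNIV. lams $ i) = 0" "(\<Sum>i\<in>UNIV. lam $ i) = 0" "rho > 0" "c\<^sup>2 = rho\<^sup>2"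
  shows "lyapunov rho (zs, lams) (z, lam)
    = 1 / rho * (\<Sum>i\<in>UNIV. (norm (lam $ i - lams $ i + c *\<^sub>R (z - zs)))\<^sup>2)"
proof -
  have "(\<Sum>i\<in>UNIV. (norm (lam $ i - lams $ i + c *\<^sub>R (z - zs)))\<^sup>2)
    = (\<Sum>i\<in>UNIV. (norm (lam $ i - lams $ i))\<^sup>2) + real CARD('N) * (rho\<^sup>2 * (norm (z - zs))\<^sup>2)"
    using assms by (subst sum_norm_add_centered) (auto simp: sum_subtractf power_mult_distrib)
  then show ?thesis
    using assms(3) by (simp add: lyapunov_def field_simps power2_eq_square)
qed

text \<open>The polarization identity for \<open>\<parallel>a\<^sub>i + b\<^sub>i\<parallel>\<^sup>2 - \<parallel>a\<^sub>i - b\<^sub>i\<parallel>\<^sup>2\<close>. The two signs arise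
  because before the step \<open>lam\<^sub>i - rho z\<close> equals \<open>- rho x\<^sub>i - g\<^sub>i\<close>, and after it \<open>lam\<^sub>i + rho z\<close>
  equals \<open>rho x\<^sub>i - g\<^sub>i\<close>.\<close>

lemma lyapunov_aladin_step:
  fixes f :: "'N::finite \<Rightarrow> real^'n \<Rightarrow> ereal" and z zs :: "real^'n" and lam lams :: "real^'n^'N"
  assumes "rho > 0" "(\<Sum>i\<in>UNIV. lams $ i) = 0" "(\<Sum>i\<in>UNIV. lam $ i) = 0"
  defines "x \<equiv> local_min f rho (z, lam)"
  shows "lyapunov rho (zs, lams) (z, lam) - lyapunov rho (zs, lams) (aladin_step f rho (z, lam))
    = 4 * (\<Sum>i\<in>UNIV. (rho *\<^sub>R (z - x $ i) - lam $ i + lams $ i) \<bullet> (x $ i - zs))"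
proof -
  define a where "a i = rho *\<^sub>R (x $ i - zs)" for i
  define b where "b i = rho *\<^sub>R (z - x $ i) - lam $ i + lams $ i" for i
  obtain z' lam' where step: "aladin_step f rho (z, lam) = (z', lam')" by fastforce
  have lam': "lam' $ i = rho *\<^sub>R (x $ i - z') - (rho *\<^sub>R (z - x $ i) - lam $ i)" for i
    using step by (auto simp: aladin_step_def Let_def x_def)
  have sum': "(\<Sum>i\<in>UNIV. lam' $ i) = 0"
    using aladin_step_sum_duals[of rho f "(z, lam)"] assms(1) step by simp
  have "lyapunov rho (zs, lams) (z, lam)
      = 1 / rho * (\<Sum>i\<in>UNIV. (norm (lam $ i - lams $ i + (- rho) *\<^sub>R (z - zs)))\<^sup>2)"
    by (rule lyapunov_eq_sum) (use assms in auto)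
  also have "(\<Sum>i\<in>UNIV. (norm (lam $ i - lams $ i + (- rho) *\<^sub>R (z - zs)))\<^sup>2)
      = (\<Sum>i\<in>UNIV. (norm (a i + b i))\<^sup>2)"
  proof (intro sum.cong refl)
    fix i
    have "lam $ i - lams $ i + (- rho) *\<^sub>R (z - zs) = - (a i + b i)"
      by (simp add: a_def b_def algebra_simps)
    then show "(norm (lam $ i - lams $ i + (- rho) *\<^sub>R (z - zs)))\<^sup>2 = (norm (a i + b i))\<^sup>2"
      by (simp only: norm_minus_cancel)
  qed
  finally have old: "lyapunov rho (zs, lams) (z, lam) = 1 / rho * (\<Sum>i\<in>UNIV. (norm (a i + b i))\<^sup>2)" .
  have "lyapunov rho (zs, lams) (z', lam')
      = 1 / rho * (\<Sum>i\<in>UNIV. (norm (lam' $ i - lams $ i + rho *\<^sub>R (z' - zs)))\<^sup>2)"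
    by (rule lyapunov_eq_sum) (use assms sum' in auto)
  also have "(\<Sum>i\<in>UNIV. (norm (lam' $ i - lams $ i + rho *\<^sub>R (z' - zs)))\<^sup>2)
      = (\<Sum>i\<in>UNIV. (norm (a i - b i))\<^sup>2)"
  proof (intro sum.cong refl)
    fix i
    have "lam' $ i - lams $ i + rho *\<^sub>R (z' - zs) = a i - b i"
      by (simp add: a_def b_def lam' algebra_simps)
    then show "(norm (lam' $ i - lams $ i + rho *\<^sub>R (z' - zs)))\<^sup>2 = (norm (a i - b i))\<^sup>2"
      by (simp only:)
  qed
  finally have new: "lyapunov rho (zs, lams) (z', lam') = 1 / rho * (\<Sum>i\<in>UNIV. (norm (a i - b i))\<^sup>2)" .
  have "(\<Sum>i\<in>UNIV. (norm (a i + b i))\<^sup>2) - (\<Sum>i\<in>UNIV. (norm (a i - b i))\<^sup>2)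
      = (\<Sum>i\<in>UNIV. 4 * rho * (b i \<bullet> (x $ i - zs)))"
    unfolding sum_subtractf[symmetric] power2_norm_eq_inner
    by (intro sum.cong refl) (simp add: a_def inner_commute algebra_simps)
  then show ?thesis
    using assms(1) unfolding step old new right_diff_distrib[symmetric]
    by (simp add: b_def sum_distrib_left[symmetric])
qed

lemma lyapunov_nonneg: "rho > 0 \<Longrightarrow> 0 \<le> lyapunov rho p q"
  by (cases p; cases q) (simp add: lyapunov_def sum_nonneg)

lemma lyapunov_bounds:
  fixes z :: "real^'n" and lam :: "real^'n^'N::finite"
  assumes "rho > 0"
  shows "rho * real CARD('N) * (norm (z - zs))\<^sup>2 \<le> lyapunov rho (zs, lams) (z, lam)"
    and "1 / rho * (norm (lam - lams))\<^sup>2 \<le> lyapunov rho (zs, lams) (z, lam)"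
proof -
  have "(norm (lam - lams))\<^sup>2 = (\<Sum>i\<in>UNIV. (norm (lam $ i - lams $ i))\<^sup>2)"
    by (simp add: power2_norm_eq_inner inner_vec_def)
  then have "lyapunov rho (zs, lams) (z, lam)
      = 1 / rho * (norm (lam - lams))\<^sup>2 + rho * real CARD('N) * (norm (z - zs))\<^sup>2"
    by (simp add: lyapunov_def)
  moreover have "0 \<le> 1 / rho * (norm (lam - lams))\<^sup>2" "0 \<le> rho * real CARD('N) * (norm (z - zs))\<^sup>2"
    using assms by simp_all
  ultimately show "rho * real CARD('N) * (norm (z - zs))\<^sup>2 \<le> lyapunov rho (zs, lams) (z, lam)"
    and "1 / rho * (norm (lam - lams))\<^sup>2 \<le> lyapunov rho (zs, lams) (z, lam)"
    by linarith+
qed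

lemma lyapunov_tendsto_zero_imp_tendsto:
  fixes s :: "nat \<Rightarrow> (real^'n) \<times> (real^'n^'N::finite)"
  assumes rho: "rho > 0" and lim: "(\<lambda>k. lyapunov rho (zs, lams) (s k)) \<longlonglongrightarrow> 0"
  shows "s \<longlonglongrightarrow> (zs, lams)"
proof -
  let ?L = "\<lambda>k. lyapunov rho (zs, lams) (s k)"
  have dominated: "u \<longlonglongrightarrow> l" if c: "c > 0" and le: "\<And>k. c * (norm (u k - l))\<^sup>2 \<le> ?L k"
    for c l and u :: "nat \<Rightarrow> 'b::real_normed_vector"
  proof -
    have "norm (u k - l) \<le> sqrt (?L k / c)" for k
      using le[of k] c by (intro real_le_rsqrt) (simp add: field_simps)
    moreover have "(\<lambda>k. sqrt (?L k / c)) \<longlonglongrightarrow> sqrt (0 / c)"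
      by (intro tendsto_intros lim) (use c in simp)
    ultimately have "(\<lambda>k. u k - l) \<longlonglongrightarrow> 0"
      by (intro Lim_null_comparison[of "\<lambda>k. u k - l" "\<lambda>k. sqrt (?L k / c)"]) simp_all
    then show ?thesis by (simp add: LIM_zero_iff)
  qed
  have "rho * real CARD('N) * (norm (fst (s k) - zs))\<^sup>2 \<le> ?L k"
    "1 / rho * (norm (snd (s k) - lams))\<^sup>2 \<le> ?L k" for k
    using lyapunov_bounds[OF rho, where z = "fst (s k)" and lam = "snd (s k)" and zs = zs and lams = lams]
    by (simp_all only: prod.collapse)
  then have "(\<lambda>k. fst (s k)) \<longlonglongrightarrow> zs" "(\<lambda>k. snd (s k)) \<longlonglongrightarrow> lams"
    using rho by (auto intro: dominated[of "rho * real CARD('N)"] dominated[of "1 / rho"])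
  then have "(\<lambda>k. (fst (s k), snd (s k))) \<longlonglongrightarrow> (zs, lams)"
    by (rule tendsto_Pair)
  then show ?thesis by simp
qed

section \<open>Linear convergence and uniqueness\<close>

text \<open>Summing the strong subgradient inequalities at \<open>zs\<close> removes the linear terms, because the
  multipliers sum to zero, and leaves quadratic growth of the objective along the diagonal.\<close>

lemma consensus_solution_unique:
  fixes f :: "'N::finite \<Rightarrow> real^'n \<Rightarrow> ereal"
  assumes m: "m > 0" and sc: "\<And>i. strongly_convex_fun m (f i)"
    and duals: "optimal_duals f zs lams" and sol: "consensus_solution f x z"
  shows "z = zs"
proof -
  have sub: "proximal_subgradient 0 (f i) zs (- (lams $ i))" for i
    using duals by (simp add: optimal_duals_def subdifferential_iff_proximal_subgradient)
  have "\<forall>i. \<exists>c. f i zs = ereal c" using sub by (auto simp: proximal_subgradient_def)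
  then obtain c where c: "\<And>i. f i zs = ereal (c i)" by metis
  have x: "x $ i = z" for i using sol by (simp add: consensus_solution_def is_arg_min_def)
  have "separable_sum f x \<le> separable_sum f (\<chi> i. zs)"
    using sol unfolding consensus_solution_def is_arg_min_linorder
    by (elim conjE allE[of _ "(\<chi> i. zs, zs)"]) simp
  then have le: "(\<Sum>i\<in>UNIV. f i z) \<le> ereal (\<Sum>i\<in>UNIV. c i)"
    by (simp add: separable_sum_def x c)
  have fin: "\<bar>f i z\<bar> \<noteq> \<infinity>" for i
  proof -
    have "f i z \<noteq> - \<infinity>" for i
      using sub[of i] c[of i] by (auto simp: proximal_subgradient_def dest: spec[of _ z])
    moreover have "f i z \<noteq> \<infinity>"
      using le sum_Pinfty[of "\<lambda>i. f i z" UNIV] by auto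
    ultimately show ?thesis by auto
  qed
  then have "\<forall>i. \<exists>d. f i z = ereal d" by auto
  then obtain d where d: "\<And>i. f i z = ereal (d i)" by metis
  have "(\<Sum>i\<in>UNIV. c i + - (lams $ i) \<bullet> (z - zs) + m / 2 * (norm (z - zs))\<^sup>2) \<le> (\<Sum>i\<in>UNIV. d i)"
    by (intro sum_mono proximal_subgradient_strongly_convex[OF sc sub c d])
  also have "\<dots> \<le> (\<Sum>i\<in>UNIV. c i)" using le by (simp add: d)
  also have "(\<Sum>i\<in>UNIV. c i + - (lams $ i) \<bullet> (z - zs) + m / 2 * (norm (z - zs))\<^sup>2)
      = (\<Sum>i\<in>UNIV. c i) - (\<Sum>i\<in>UNIV. lams $ i) \<bullet> (z - zs) + real CARD('N) * (m / 2 * (norm (z - zs))\<^sup>2)"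
    by (simp add: sum.distrib sum_subtractf inner_sum_left)
  also have "(\<Sum>i\<in>UNIV. lams $ i) = 0" using duals by (simp add: optimal_duals_def)
  finally have "real CARD('N) * (m / 2 * (norm (z - zs))\<^sup>2) \<le> 0" by simp
  then have "(norm (z - zs))\<^sup>2 \<le> 0" using m by (simp add: mult_le_0_iff)
  then show ?thesis by simp
qed

text \<open>Comparing the minimizer with \<open>z\<close> itself, strong monotonicity gives
  \<open>m \<parallel>x - z\<parallel>\<^sup>2 \<le> - rho \<parallel>x - z\<parallel>\<^sup>2\<close>, so \<open>x = z\<close>.\<close>

lemma aladin_step_fixed_point:
  fixes f :: "'N::finite \<Rightarrow> real^'n \<Rightarrow> ereal"
  assumes "\<And>i. closed_fun (f i)" and rho: "rho > 0" and m: "m > 0"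
    and "\<And>i. strongly_convex_fun m (f i)" and duals: "optimal_duals f z lam"
  shows "local_min f rho (z, lam) $ i = z" and "aladin_step f rho (z, lam) = (z, lam)"
proof -
  have sub: "- (lam $ i) \<in> subdifferential (f i) z" for i
    using duals by (simp add: optimal_duals_def)
  show x: "local_min f rho (z, lam) $ i = z" for i
  proof -
    let ?x = "local_min f rho (z, lam) $ i"
    have "m * (norm (?x - z))\<^sup>2 \<le> (rho *\<^sub>R (z - ?x) - lam $ i + lam $ i) \<bullet> (?x - z)"
      by (rule local_min_strongly_monotone) (use assms sub in auto)
    also have "\<dots> = - rho * (norm (?x - z))\<^sup>2"
      unfolding power2_norm_eq_inner by (simp add: inner_diff_left inner_diff_right algebra_simps)
    finally have "(m + rho) * (norm (?x - z))\<^sup>2 \<le> 0" by (simp add: algebra_simps)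
    then show ?thesis using m rho by (auto simp: mult_le_0_iff)
  qed
  have "(\<Sum>i\<in>UNIV. z + (1 / rho) *\<^sub>R lam $ i)
      = real CARD('N) *\<^sub>R z + (1 / rho) *\<^sub>R (\<Sum>i\<in>UNIV. lam $ i)"
    by (simp only: sum.distrib scaleR_sum_right sum_constant_scaleR)
  also have "\<dots> = real CARD('N) *\<^sub>R z"
    using duals by (simp add: optimal_duals_def)
  finally show "aladin_step f rho (z, lam) = (z, lam)"
    by (simp add: aladin_step_def Let_def x vec_eq_iff)
qed

lemma aladin_step_contraction:
  fixes f :: "'N::finite \<Rightarrow> real^'n \<Rightarrow> ereal"
  assumes "\<And>i. closed_fun (f i)" and rho: "rho > 0"
    and "\<And>i. strongly_convex_fun m (f i)" and duals: "optimal_duals f zs lams"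
    and \<delta>: "\<delta> > 0" and sum: "(\<Sum>i\<in>UNIV. snd s $ i) = 0"
    and descent: "descent_condition f rho m \<delta> (zs, lams) s"
  shows "sqrt (lyapunov rho (zs, lams) (aladin_step f rho s))
    \<le> 1 / sqrt (1 + \<delta>) * sqrt (lyapunov rho (zs, lams) s)"
proof -
  obtain z lam where s: "s = (z, lam)" by (cases s)
  let ?x = "\<lambda>i. local_min f rho (z, lam) $ i"
  let ?L = "lyapunov rho (zs, lams)"
  have "(\<Sum>i\<in>UNIV. m * (norm (?x i - zs))\<^sup>2)
      \<le> (\<Sum>i\<in>UNIV. (rho *\<^sub>R (z - ?x i) - lam $ i + lams $ i) \<bullet> (?x i - zs))"
    by (intro sum_mono local_min_strongly_monotone) (use assms in \<open>auto simp: optimal_duals_def\<close>)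
  moreover have "?L (z, lam) - ?L (aladin_step f rho (z, lam))
      = 4 * (\<Sum>i\<in>UNIV. (rho *\<^sub>R (z - ?x i) - lam $ i + lams $ i) \<bullet> (?x i - zs))"
    by (rule lyapunov_aladin_step) (use assms s in \<open>auto simp: optimal_duals_def\<close>)
  moreover have "\<delta> * ?L (aladin_step f rho s) \<le> 4 * (\<Sum>i\<in>UNIV. m * (norm (?x i - zs))\<^sup>2)"
    using descent by (simp add: descent_condition_def s sum_distrib_left mult.assoc)
  ultimately have "(1 + \<delta>) * ?L (aladin_step f rho s) \<le> ?L s"
    by (simp add: s algebra_simps)
  then have "?L (aladin_step f rho s) \<le> ?L s / (1 + \<delta>)"
    using \<delta> by (simp add: field_simps)
  then have "sqrt (?L (aladin_step f rho s)) \<le> sqrt (?L s / (1 + \<delta>))"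
    by (rule real_sqrt_le_mono)
  then show ?thesis by (simp add: real_sqrt_divide)
qed

theorem theorem7:
  fixes f :: "'N::finite \<Rightarrow> real^'n \<Rightarrow> ereal"
    and rho m \<delta> :: real
    and zs :: "real^'n" and lams :: "real^'n^'N"
  assumes "rho > 0"
    and "\<And>i. closed_fun (f i)" and "\<And>i. proper_fun (f i)"
    and "m > 0" and "strongly_convex_fun m (separable_sum f)"
    and "consensus_solution f (\<chi> i. zs) zs" and "optimal_duals f zs lams"
    and "\<delta> > 0"
  shows
    "(\<forall>z0 lam0. (\<Sum>i\<in>UNIV. lam0 $ i) = 0 \<longrightarrow>
        (\<forall>k. descent_condition f rho m \<delta> (zs, lams) ((aladin_step f rho ^^ k) (z0, lam0))) \<longrightarrow>
        (\<forall>k. sqrt (lyapunov rho (zs, lams) ((aladin_step f rho ^^ Suc k) (z0, lam0)))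
               \<le> 1 / sqrt (1 + \<delta>)
                 * sqrt (lyapunov rho (zs, lams) ((aladin_step f rho ^^ k) (z0, lam0)))) \<and>
        (\<lambda>k. (aladin_step f rho ^^ k) (z0, lam0)) \<longlonglongrightarrow> (zs, lams)) \<and>
     (\<forall>x z. consensus_solution f x z \<longrightarrow> x = (\<chi> i. zs) \<and> z = zs) \<and>
     ((\<forall>z lam. (\<Sum>i\<in>UNIV. lam $ i) = 0 \<longrightarrow> descent_condition f rho m \<delta> (zs, lams) (z, lam)) \<longrightarrow>
        (\<forall>x z lam. consensus_solution f x z \<and> optimal_duals f z lam \<longrightarrow> (z, lam) = (zs, lams)))"
proof (intro conjI)
  have sub: "- (lams $ i) \<in> subdifferential (f i) zs" for i
    using assms(7) by (simp add: optimal_duals_def)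
  have sc: "strongly_convex_fun m (f i)" for i
    by (rule strongly_convex_fun_component[OF assms(5), of zs])
      (use sub in \<open>auto simp: subdifferential_def\<close>)
  have unique: "z = zs" if "consensus_solution f x z" for x z
    using consensus_solution_unique[OF assms(4) sc assms(7) that] .
  show "\<forall>x z. consensus_solution f x z \<longrightarrow> x = (\<chi> i. zs) \<and> z = zs"
  proof (intro allI impI)
    fix x z
    assume sol: "consensus_solution f x z"
    then have "x = (\<chi> i. z)"
      unfolding consensus_solution_def is_arg_min_def by (simp add: vec_eq_iff)
    with unique[OF sol] show "x = (\<chi> i. zs) \<and> z = zs" by simp
  qed
  show "(\<forall>z lam. (\<Sum>i\<in>UNIV. lam $ i) = 0 \<longrightarrow> descent_condition f rho m \<delta> (zs, lams) (z, lam)) \<longrightarrow>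
      (\<forall>x z lam. consensus_solution f x z \<and> optimal_duals f z lam \<longrightarrow> (z, lam) = (zs, lams))"
  proof (intro impI allI, elim conjE)
    fix x z lam
    assume descent: "\<forall>z lam. (\<Sum>i\<in>UNIV. lam $ i) = 0 \<longrightarrow> descent_condition f rho m \<delta> (zs, lams) (z, lam)"
      and sol: "consensus_solution f x z" and "optimal_duals f z lam"
    then have z: "z = zs" and duals: "optimal_duals f zs lam" using unique[OF sol] by simp_all
    note fixed = aladin_step_fixed_point[OF assms(2,1,4) sc duals]
    have "descent_condition f rho m \<delta> (zs, lams) (zs, lam)"
      using descent duals by (simp add: optimal_duals_def)
    then have "\<delta> * lyapunov rho (zs, lams) (zs, lam) \<le> 0"
      by (simp add: descent_condition_def fixed)
    then have "lyapunov rho (zs, lams) (zs, lam) \<le> 0"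
      using assms(8) by (simp add: mult_le_0_iff)
    with lyapunov_bounds(2)[OF assms(1), of lam lams zs zs]
    have "1 / rho * (norm (lam - lams))\<^sup>2 \<le> 0" by linarith
    then have "(norm (lam - lams))\<^sup>2 \<le> 0" using assms(1) by (simp add: divide_le_0_iff)
    then show "(z, lam) = (zs, lams)" using z by simp
  qed
  show "\<forall>z0 lam0. (\<Sum>i\<in>UNIV. lam0 $ i) = 0 \<longrightarrow>
      (\<forall>k. descent_condition f rho m \<delta> (zs, lams) ((aladin_step f rho ^^ k) (z0, lam0))) \<longrightarrow>
      (\<forall>k. sqrt (lyapunov rho (zs, lams) ((aladin_step f rho ^^ Suc k) (z0, lam0)))
             \<le> 1 / sqrt (1 + \<delta>)
               * sqrt (lyapunov rho (zs, lams) ((aladin_step f rho ^^ k) (z0, lam0)))) \<and>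
      (\<lambda>k. (aladin_step f rho ^^ k) (z0, lam0)) \<longlonglongrightarrow> (zs, lams)"
  proof (intro allI impI)
    fix z0 :: "real^'n" and lam0 :: "real^'n^'N"
    assume sum0: "(\<Sum>i\<in>UNIV. lam0 $ i) = 0"
      and descent: "\<forall>k. descent_condition f rho m \<delta> (zs, lams) ((aladin_step f rho ^^ k) (z0, lam0))"
    define s where "s k = (aladin_step f rho ^^ k) (z0, lam0)" for k
    define r where "r = 1 / sqrt (1 + \<delta>)"
    let ?d = "\<lambda>k. sqrt (lyapunov rho (zs, lams) (s k))"
    have s_Suc: "s (Suc k) = aladin_step f rho (s k)" for k by (simp add: s_def)
    have sum: "(\<Sum>i\<in>UNIV. snd (s k) $ i) = 0" for k
      using sum0 aladin_step_sum_duals[of rho f] assms(1) by (cases k) (simp_all add: s_def)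
    have rate: "?d (Suc k) \<le> r * ?d k" for k
      unfolding s_Suc r_def
      by (rule aladin_step_contraction[OF assms(2,1) sc assms(7,8) sum])
        (use descent in \<open>simp add: s_def\<close>)
    have r: "0 \<le> r" "r < 1" using assms(8) by (simp_all add: r_def)
    have geometric: "?d k \<le> r ^ k * ?d 0" for k
    proof (induction k)
      case (Suc k)
      have "?d (Suc k) \<le> r * ?d k" by (rule rate)
      also have "\<dots> \<le> r * (r ^ k * ?d 0)" using Suc r(1) by (rule mult_left_mono)
      finally show ?case by (simp add: mult.assoc)
    qed simp
    have nonneg: "0 \<le> lyapunov rho (zs, lams) (s k)" for k
      by (rule lyapunov_nonneg[OF assms(1)])
    have "(\<lambda>k. r ^ k * ?d 0) \<longlonglongrightarrow> 0 * ?d 0"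
      by (intro tendsto_intros LIMSEQ_power_zero) (use r in simp)
    then have "(\<lambda>k. r ^ k * ?d 0) \<longlonglongrightarrow> 0" by simp
    then have "?d \<longlonglongrightarrow> 0"
      by (rule Lim_null_comparison[rotated]) (use geometric nonneg in simp)
    then have "(\<lambda>k. (?d k)\<^sup>2) \<longlonglongrightarrow> 0\<^sup>2" by (rule tendsto_power)
    then have "(\<lambda>k. lyapunov rho (zs, lams) (s k)) \<longlonglongrightarrow> 0" using nonneg by simp
    then have "s \<longlonglongrightarrow> (zs, lams)" by (rule lyapunov_tendsto_zero_imp_tendsto[OF assms(1)])
    with rate show "(\<forall>k. sqrt (lyapunov rho (zs, lams) ((aladin_step f rho ^^ Suc k) (z0, lam0)))
        \<le> 1 / sqrt (1 + \<delta>)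
          * sqrt (lyapunov rho (zs, lams) ((aladin_step f rho ^^ k) (z0, lam0)))) \<and>
      (\<lambda>k. (aladin_step f rho ^^ k) (z0, lam0)) \<longlonglongrightarrow> (zs, lams)"
      unfolding r_def s_def by blast
  qed
qed

end
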